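(* Assume the following statement holds: for every positive integer $k$ and every probability distribution on $\mathcal P_k$, if $\pi_1,\pi_2$ are sampled independently from this distribution then $\mathbb{E}[\mathrm{LCS}(\pi_1,\pi_2)]\geq\sqrt{k}$. Then for every fixed integer $k\geq 2$, \[ \mathrm{LT}(k,n)/n\geq\tfrac{1}{100}k^{-12/19}\log^{-8/19}k-o(1)\quad\text{as } n\to\infty. \]
   Context: $\mathcal{P}_k$ is the set of permutations on $k$ letters (words over $[k]=\{1,\dots,k\}$ in which each letter occurs exactly once). $\mathrm{LCS}(w,w')$ is the length of a longest common subsequence of words $w,w'$. Two subsequences of a word $w$ are twins if they are equal as words and use disjoint sets of positions of $w$; $\mathrm{LT}(w)$ is the maximum length of twins in $w$ and $\mathrm{LT}(k,n)=\min_{w\in[k]^n}\mathrm{LT}(w)$. $\log$ is the natural logarithm. *)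

theory Defs
  imports "HOL-Probability.Probability" "HOL-Library.Sublist"
begin

definition perms :: "nat \<Rightarrow> nat list set" where
  "perms k = {w. distinct w \<and> set w = {1..k}}"

definition LCS :: "nat list \<Rightarrow> nat list \<Rightarrow> nat" where
  "LCS w w' = Max (length ` {zs. subseq zs w \<and> subseq zs w'})"

definition LT_word :: "nat list \<Rightarrow> nat" where
  "LT_word w = Max {length (nths w I) | I J. I \<inter> J = {} \<and> nths w I = nths w J}"

definition LT :: "nat \<Rightarrow> nat \<Rightarrow> nat" where
  "LT k n = Min {LT_word w | w. length w = n \<and> set w \<subseteq> {1..k}}"

end

(*
Cut the word into N blocks of equal length M, with M of order k^(18/19) (log k)^(12/19).

If half of the blocks have at most M/4 distinct letters, each of them contains about M/6 disjoint
triples of equal letters.  For any two triples, two of the three coordinatewise comparisons agree,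
so an Erdos-Szekeres labelling gives twins of length (M/6)^(1/3) in such a block.

Otherwise some set S of at least M/16 letters is such that every letter of S occurs in a proportion
at least q = M/(16k) of the blocks.  Concatenate about (log k)/q independent random blocks, keep one
occurrence of each letter of S and append the few letters that are missing: this is a random
permutation of S, and the hypothesis bounds from below the average LCS of two random blocks.  By
averaging over d, for some d the blocks i and i + d have a large common subsequence on average; using
the i with even i div d, or those with odd i div d, makes these common subsequences into twins.
*)
theory Submission
  imports Defs
begin

section \<open>Extremal witnesses for twins and common subsequences\<close>

text \<open>The index sets range over all sets of naturals, so there are infinitely many pairs, but
  the lengths they produce are bounded by \<open>length w\<close>. This is what makes the
  \<open>Max\<close> in \<open>LT_word\<close> an attained maximum.\<close>

lemma LT_word_set_finite:
  "finite {length (nths w I) | I J. I \<inter> J = {} \<and> nths w I = nths w J}"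
proof (rule finite_subset[of _ "{..length w}"])
  have "length (nths w I) \<le> length w" for I
    by (metis subseq_conv_nths list_emb_length)
  then show "{length (nths w I) | I J. I \<inter> J = {} \<and> nths w I = nths w J} \<subseteq> {..length w}"
    by blast
qed simp

lemma LT_word_ge:
  assumes "I \<inter> J = {}" "nths w I = nths w J"
  shows "length (nths w I) \<le> LT_word w"
  unfolding LT_word_def using assms by (intro Max_ge LT_word_set_finite) blast

lemma LT_word_witness:
  obtains I J where "I \<inter> J = {}" "nths w I = nths w J" "LT_word w = length (nths w I)"
proof -
  have "nths w {} = nths w {}" by simp
  then have "{length (nths w I) | I J. I \<inter> J = {} \<and> nths w I = nths w J} \<noteq> {}" by blast
  from Max_in[OF LT_word_set_finite this] that show ?thesis
    unfolding LT_word_def by blast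
qed

lemma LCS_set_finite: "finite (length ` {zs. subseq zs w \<and> subseq zs w'})"
  by (rule finite_subset[of _ "{..length w}"]) (auto dest: list_emb_length)

lemma LCS_ge: "subseq zs w \<Longrightarrow> subseq zs w' \<Longrightarrow> length zs \<le> LCS w w'"
  unfolding LCS_def by (intro Max_ge LCS_set_finite) blast

lemma LCS_witness:
  obtains zs where "subseq zs w" "subseq zs w'" "LCS w w' = length zs"
proof -
  have "[] \<in> {zs. subseq zs w \<and> subseq zs w'}" by simp
  then have "length ` {zs. subseq zs w \<and> subseq zs w'} \<noteq> {}" by blast
  from Max_in[OF LCS_set_finite this] that show ?thesis
    unfolding LCS_def by blast
qed

lemma LCS_le_length: "LCS u v \<le> length u"
  by (metis LCS_witness list_emb_length)

lemma LCS_commute: "LCS u v = LCS v u"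
  by (simp add: LCS_def conj_commute)

lemma LCS_mono: "subseq u u' \<Longrightarrow> subseq v v' \<Longrightarrow> LCS u v \<le> LCS u' v'"
  by (metis LCS_ge LCS_witness subseq_order.trans)

lemma LCS_append_left: "LCS (a @ b) c \<le> LCS a c + LCS b c"
proof -
  obtain zs where zs: "subseq zs (a @ b)" "subseq zs c" "LCS (a @ b) c = length zs"
    by (rule LCS_witness)
  from zs(1) obtain xs ys where s: "zs = xs @ ys" "subseq xs a" "subseq ys b"
    by (auto simp: subseq_append_iff)
  have "subseq xs c" "subseq ys c"
    using zs(2) s(1) by (auto intro: subseq_order.trans[rotated])
  with s zs(3) show ?thesis by (simp add: LCS_ge add_mono)
qed

lemma LCS_append_right: "LCS c (a @ b) \<le> LCS c a + LCS c b"
  using LCS_append_left[of a b c] by (simp add: LCS_commute)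

lemma LCS_superadditive: "LCS a c + LCS b d \<le> LCS (a @ b) (c @ d)"
  by (metis LCS_ge LCS_witness length_append list_emb_append_mono)

text \<open>Iterates subadditivity in both arguments. The sum over all pairs is linear in the block
  values, so its average over random lists of blocks can be computed exactly.\<close>

lemma LCS_concat: "LCS (concat us) (concat vs) \<le> (\<Sum>u\<leftarrow>us. \<Sum>v\<leftarrow>vs. LCS u v)"
proof (induction us)
  case Nil
  then show ?case using LCS_le_length[of "[]"] by simp
next
  case (Cons u us)
  have "LCS u (concat vs) \<le> (\<Sum>v\<leftarrow>vs. LCS u v)"
  proof (induction vs)
    case Nil
    then show ?case using LCS_le_length[of "[]" u] by (simp add: LCS_commute)
  next
    case (Cons v vs)
    then show ?case using LCS_append_right[of u v "concat vs"] by simp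
  qed
  with Cons show ?case using LCS_append_left[of u "concat us" "concat vs"] by simp
qed

lemma LCS_map: "LCS u v \<le> LCS (map h u) (map h v)"
  by (metis LCS_ge LCS_witness length_map subseq_map)

lemma subseq_remdups: "subseq (remdups xs) xs"
  by (induction xs) (auto intro: subseq_order.trans)

section \<open>Twins in concatenated words\<close>

text \<open>\<open>I\<close> is cut down to \<open>{..<length u}\<close> because its larger
  elements, harmless in \<open>nths u I\<close>, would select letters of \<open>v\<close> in the
  concatenation.\<close>

lemma nths_append_parts:
  "nths (u @ v) (I \<inter> {..<length u} \<union> (+) (length u) ` J) = nths u I @ nths v J"
proof -
  have "nths u (I \<inter> {..<length u} \<union> (+) (length u) ` J) = nths u I"
    unfolding nths_def by (intro arg_cong[where f="map fst"] filter_cong) (auto simp: set_zip)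
  moreover have "{j. j + length u \<in> I \<inter> {..<length u} \<union> (+) (length u) ` J} = J"
    by (auto simp: add.commute)
  ultimately show ?thesis by (simp add: nths_append)
qed

lemma LT_word_superadditive: "LT_word u + LT_word v \<le> LT_word (u @ v)"
proof -
  obtain I J where u: "I \<inter> J = {}" "nths u I = nths u J" "LT_word u = length (nths u I)"
    by (rule LT_word_witness)
  obtain I' J' where v: "I' \<inter> J' = {}" "nths v I' = nths v J'" "LT_word v = length (nths v I')"
    by (rule LT_word_witness)
  have "(I \<inter> {..<length u} \<union> (+) (length u) ` I') \<inter> (J \<inter> {..<length u} \<union> (+) (length u) ` J') = {}"
    using u(1) v(1) by auto
  from LT_word_ge[OF this, of "u @ v"] u v show ?thesis by (simp add: nths_append_parts)
qed

text \<open>The two copies of a common subsequence lie in different factors, hence at disjoint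
  positions.\<close>

lemma LCS_le_LT_word: "LCS u v \<le> LT_word (u @ v)"
proof -
  obtain zs where zs: "subseq zs u" "subseq zs v" "LCS u v = length zs"
    by (rule LCS_witness)
  obtain I where I: "zs = nths u I"
    using zs(1) by (auto simp: subseq_conv_nths)
  obtain J where J: "zs = nths v J"
    using zs(2) by (auto simp: subseq_conv_nths)
  note IJ = I[symmetric] J[symmetric]
  have "(I \<inter> {..<length u} \<union> (+) (length u) ` {}) \<inter> ({} \<inter> {..<length u} \<union> (+) (length u) ` J) = {}"
    by auto
  from LT_word_ge[OF this, of "u @ v"] zs IJ show ?thesis
    by (simp add: nths_append_parts[of u v I "{}", simplified] nths_append_parts[of u v "{}" J, simplified])
qed

lemma LT_word_concat: "(\<Sum>u\<leftarrow>us. LT_word u) \<le> LT_word (concat us)"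
  by (induction us) (auto intro: order.trans[OF _ LT_word_superadditive])

section \<open>Twins from triples of equal letters, after Erdos and Szekeres\<close>

text \<open>Links increasing lists of positions, the form in which chains arise, with the index sets
  used by \<open>LT_word\<close>.\<close>

lemma nths_eq_map_nth:
  assumes "sorted_wrt (<) xs" "\<And>x. x \<in> set xs \<Longrightarrow> x < length w"
  shows "nths w (set xs) = map ((!) w) xs"
proof -
  have "filter (\<lambda>i. i \<in> set xs) [0..<length w] = xs"
    using assms by (intro sorted_distinct_set_unique) (auto simp: strict_sorted_iff intro: sorted_wrt_filter)
  moreover have "nths w (set xs) = map ((!) w) (filter (\<lambda>i. i \<in> set xs) [0..<length w])"
  proof -
    have "zip w [0..<length w] = map (\<lambda>i. (w ! i, i)) [0..<length w]"
      by (rule nth_equalityI) auto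
    then show ?thesis
      by (simp add: nths_def filter_map o_def)
  qed
  ultimately show ?thesis by simp
qed

text \<open>Erdos-Szekeres labelling: \<open>e\<close> receives, for each \<open>i < m\<close>, the
  length \<open>h i e\<close> of a longest \<open>R i\<close>-chain that it extends. If
  \<open>R i e f\<close> then the \<open>i\<close>-th label grows strictly from \<open>e\<close> to
  \<open>f\<close>, so distinct elements have distinct label vectors in
  \<open>{..<s} ^ m\<close>.\<close>

lemma card_le_power_chain_bound:
  fixes R :: "nat \<Rightarrow> 'a \<Rightarrow> 'a \<Rightarrow> bool"
  assumes fin: "finite E"
    and trans: "\<And>i. i < m \<Longrightarrow> transp (R i)"
    and cmp: "\<And>e f. e \<in> E \<Longrightarrow> f \<in> E \<Longrightarrow> e \<noteq> f \<Longrightarrow> \<exists>i<m. R i e f \<or> R i f e"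
    and bound: "\<And>i es. i < m \<Longrightarrow> set es \<subseteq> E \<Longrightarrow> sorted_wrt (R i) es \<Longrightarrow> length es \<le> s"
  shows "card E \<le> s ^ m"
proof -
  \<comment> \<open>The element \<open>e\<close> closes the chain but is not counted in its length;
    thus labels start at 0 and stay strictly below \<open>s\<close>.\<close>
  define C where "C i e = {es. set es \<subseteq> E \<and> sorted_wrt (R i) (es @ [e])}" for i e
  define h where "h i e = Max (length ` C i e)" for i e
  have finC: "finite (length ` C i e)" if "i < m" for i e
  proof (rule finite_subset)
    show "length ` C i e \<subseteq> {..s}"
      using bound[OF that] unfolding C_def sorted_wrt_append by blast
  qed simp
  have wit: "\<exists>es\<in>C i e. h i e = length es" if "i < m" for i e
  proof -
    have "[] \<in> C i e" by (simp add: C_def)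
    then have "length ` C i e \<noteq> {}" by blast
    from Max_in[OF finC[OF that] this] show ?thesis by (auto simp: h_def)
  qed
  have h_less: "h i e < s" if ie: "i < m" "e \<in> E" for i e
  proof -
    obtain es where "es \<in> C i e" "h i e = length es" using wit[OF ie(1)] by blast
    moreover from this have "length (es @ [e]) \<le> s"
      using ie(2) by (intro bound[OF ie(1)]) (auto simp: C_def)
    ultimately show ?thesis by simp
  qed
  have h_mono: "h i e < h i f" if ie: "i < m" "e \<in> E" "R i e f" for i e f
  proof -
    obtain es where es: "es \<in> C i e" "h i e = length es" using wit[OF ie(1)] by blast
    have "es @ [e] \<in> C i f"
      using es(1) ie(2,3) transpD[OF trans[OF ie(1)], of _ e f]
      by (auto simp: C_def sorted_wrt_append)
    then have "length (es @ [e]) \<le> h i f"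
      unfolding h_def by (intro Max_ge finC ie) blast
    with es(2) show ?thesis by simp
  qed
  have inj: "inj_on (\<lambda>e. \<lambda>i\<in>{..<m}. h i e) E"
  proof (rule inj_onI, rule ccontr)
    fix e f assume ef: "e \<in> E" "f \<in> E" "(\<lambda>i\<in>{..<m}. h i e) = (\<lambda>i\<in>{..<m}. h i f)" "e \<noteq> f"
    from cmp[OF ef(1,2,4)] obtain i where i: "i < m" "R i e f \<or> R i f e" by blast
    from fun_cong[OF ef(3), of i] i(1) have "h i e = h i f" by simp
    with h_mono[OF i(1) ef(1), of f] h_mono[OF i(1) ef(2), of e] i(2) show False by auto
  qed
  have "card E \<le> card ({..<m} \<rightarrow>\<^sub>E {..<s})"
    by (rule card_inj_on_le[OF inj]) (auto simp: h_less intro!: finite_PiE restrict_PiE_iff[THEN iffD2])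
  then show ?thesis by (simp add: card_PiE)
qed

text \<open>The occurrences of each letter are cut into consecutive triples. Two triples are
  compared in three coordinates, and two of the three comparisons agree, so they are comparable in
  one of three relations \<open>R i\<close>. A chain of \<open>R i\<close> yields twins: read its
  letters once at coordinate \<open>u i\<close> and once at coordinate \<open>v i\<close>.\<close>

lemma sum_count_div_3_le:
  "(\<Sum>a\<in>set w. count_list w a div 3) \<le> LT_word w ^ 3"
proof -
  define occ where "occ a = filter (\<lambda>i. w ! i = a) [0..<length w]" for a
  \<comment> \<open>A triple is encoded as its letter together with its index among the triples of
    that letter; \<open>P c e\<close> is the position of its entry number \<open>c\<close>.\<close>
  define E where "E = (SIGMA a:set w. {..<length (occ a) div 3})"
  define P where "P c e = occ (fst e) ! (3 * snd e + c)" for c :: nat and e :: "nat \<times> nat"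
  have len_occ: "length (occ a) = count_list w a" for a
  proof -
    have "length (occ a) = card (set (occ a))"
      by (rule distinct_card[symmetric]) (simp add: occ_def)
    also have "set (occ a) = {i. i < length w \<and> w ! i = a}"
      by (auto simp: occ_def)
    finally show ?thesis
      by (simp add: count_list_eq_length_filter length_filter_conv_card eq_commute)
  qed
  have dist: "distinct (occ a)" and sort: "sorted_wrt (<) (occ a)" for a
    by (auto simp: occ_def intro: sorted_wrt_filter)
  have ind: "3 * snd e + c < length (occ (fst e))" if "e \<in> E" "c < 3" for e c
    using that by (auto simp: E_def)
  have P_occ: "P c e \<in> set (occ (fst e))" if "e \<in> E" "c < 3" for e c
    unfolding P_def by (rule nth_mem[OF ind[OF that]])
  have P_less: "P c e < length w" and P_letter: "w ! P c e = fst e" if "e \<in> E" "c < 3" for e c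
    using P_occ[OF that] by (auto simp: occ_def)
  \<comment> \<open>A position determines both triple and coordinate. This makes all coordinate
    comparisons strict and the two copies in the twins disjoint.\<close>
  have P_inj: "e = f \<and> c = d" if "e \<in> E" "f \<in> E" "c < 3" "d < 3" "P c e = P d f" for e f c d
  proof -
    have fst: "fst e = fst f"
      using P_letter[of e c] P_letter[of f d] that by simp
    then have "3 * snd e + c = 3 * snd f + d"
      using that(5) ind[OF that(1,3)] ind[OF that(2,4)] dist
      by (simp add: P_def nth_eq_iff_index_eq)
    with that(3,4) have "snd e = snd f" "c = d" by arith+
    with fst show ?thesis by (simp add: prod_eq_iff)
  qed
  \<comment> \<open>For \<open>i\<close> = 0, 1, 2 the pair \<open>u i\<close>, \<open>v i\<close>
    runs through 01, 02 and 12.\<close>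
  define u v where "u i = (if i = 2 then 1 else 0 :: nat)" and "v i = (if i = 0 then 1 else 2 :: nat)"
    for i :: nat
  have uv: "u i < 3" "v i < 3" "u i \<noteq> v i" for i by (auto simp: u_def v_def)
  define R where "R i e f \<longleftrightarrow> P (u i) e < P (u i) f \<and> P (v i) e < P (v i) f" for i e f
  have "card E \<le> LT_word w ^ 3"
  proof (rule card_le_power_chain_bound[where R = R])
    show "finite E" by (simp add: E_def)
    show "transp (R i)" for i by (auto simp: R_def transp_def)
    show "\<exists>i<3. R i e f \<or> R i f e" if ef: "e \<in> E" "f \<in> E" "e \<noteq> f" for e f
    proof -
      have "P c e < P c f \<or> P c f < P c e" if "c < 3" for c
        using P_inj[of e f c c] that ef by (metis linorder_neqE_nat)
      from this[of 0] this[of 1] this[of 2]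
      have "R 0 e f \<or> R 0 f e \<or> R 1 e f \<or> R 1 f e \<or> R 2 e f \<or> R 2 f e"
        by (simp add: R_def u_def v_def) blast
      moreover have "0 < (3::nat)" "1 < (3::nat)" "2 < (3::nat)" by simp_all
      ultimately show ?thesis by blast
    qed
    show "length es \<le> LT_word w" if es: "set es \<subseteq> E" "sorted_wrt (R i) es" for i es
    proof -
      have *: "nths w (set (map (P c) es)) = map fst es" if c: "c = u i \<or> c = v i" for c
      proof -
        have c3: "c < 3" using c uv by auto
        have "sorted_wrt (<) (map (P c) es)"
          using c unfolding sorted_wrt_map
          by (intro sorted_wrt_mono_rel[OF _ es(2)]) (auto simp: R_def)
        then have "nths w (set (map (P c) es)) = map ((!) w) (map (P c) es)"
          using es(1) P_less c3 by (intro nths_eq_map_nth) auto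
        also have "\<dots> = map fst es" using es(1) P_letter c3 by auto
        finally show ?thesis .
      qed
      have "set (map (P (u i)) es) \<inter> set (map (P (v i)) es) = {}"
        using P_inj[OF _ _ uv(1,2)[of i]] es(1) uv(3)[of i] by (auto simp del: One_nat_def) blast
      from LT_word_ge[OF this, of w] *[of "u i"] *[of "v i"] show ?thesis by simp
    qed
  qed
  then show ?thesis by (simp add: E_def len_occ)
qed

text \<open>Each letter has at most two occurrences outside its triples.\<close>

lemma length_le_LT_word_cube: "length w \<le> 3 * LT_word w ^ 3 + 2 * card (set w)"
proof -
  have "length w = (\<Sum>a\<in>set w. count_list w a)"
    by (simp add: sum_count_set)
  also have "\<dots> \<le> (\<Sum>a\<in>set w. 3 * (count_list w a div 3) + 2)"
    by (intro sum_mono) arith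
  also have "\<dots> = 3 * (\<Sum>a\<in>set w. count_list w a div 3) + 2 * card (set w)"
    by (simp only: sum.distrib sum_distrib_left sum_constant of_nat_id mult.commute)
  finally show ?thesis using sum_count_div_3_le[of w] by linarith
qed

section \<open>Twins from common subsequences of shifted blocks\<close>

lemma concat_split_block:
  "a \<le> b \<Longrightarrow> b \<le> c \<Longrightarrow>
    concat (map B [a..<c]) = concat (map B [a..<b]) @ concat (map B [b..<c])"
  by (metis concat_append le_Suc_ex map_append upt_add_eq_append)

lemma LCS_concat_ge:
  "(\<Sum>i<d. LCS (B (a + i)) (B (b + i))) \<le> LCS (concat (map B [a..<a+d])) (concat (map B [b..<b+d]))"
proof (induction d)
  case (Suc d)
  then show ?case
    using LCS_superadditive[of "concat (map B [a..<a+d])" "concat (map B [b..<b+d])" "B (a + d)" "B (b + d)"]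
    by simp
qed simp

text \<open>From block \<open>a\<close> on, the word is cut into \<open>q\<close> superblocks of
  \<open>2 * d\<close> blocks. In each one, common subsequences of aligned blocks of the two halves
  are glued together and become twins.\<close>

lemma LT_word_superblocks:
  fixes B :: "nat \<Rightarrow> nat list"
  shows "(\<Sum>j<q. \<Sum>i<d. LCS (B (a + 2 * d * j + i)) (B (a + 2 * d * j + i + d)))
    \<le> LT_word (concat (map B [a..<a + 2 * d * q]))"
proof (induction q)
  case (Suc q)
  let ?b = "a + 2 * d * q"
  have "(\<Sum>i<d. LCS (B (?b + i)) (B (?b + i + d)))
      \<le> LCS (concat (map B [?b..<?b+d])) (concat (map B [?b+d..<?b+d+d]))"
    using LCS_concat_ge[of B ?b "?b + d" d] by (simp add: add_ac)
  also have "\<dots> \<le> LT_word (concat (map B [?b..<?b+d]) @ concat (map B [?b+d..<?b+d+d]))"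
    by (rule LCS_le_LT_word)
  also have "concat (map B [?b..<?b+d]) @ concat (map B [?b+d..<?b+d+d]) = concat (map B [?b..<a + 2 * d * Suc q])"
    by (subst concat_split_block[symmetric]) (auto simp: algebra_simps)
  finally have "(\<Sum>i<d. LCS (B (?b + i)) (B (?b + i + d))) \<le> LT_word (concat (map B [?b..<a + 2 * d * Suc q]))" .
  with Suc LT_word_superadditive[of "concat (map B [a..<?b])" "concat (map B [?b..<a + 2 * d * Suc q])"]
  show ?case
    by (subst concat_split_block[of _ ?b]) auto
qed simp

lemma sum_lessThan_add:
  fixes g :: "nat \<Rightarrow> 'a::comm_monoid_add"
  shows "(\<Sum>i<m+n. g i) = (\<Sum>i<m. g i) + (\<Sum>i<n. g (m + i))"
  by (induction n) (auto simp: add.assoc)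

text \<open>Indices with even \<open>i div d\<close> lie in first halves of superblocks that start
  at block 0, those with odd \<open>i div d\<close> in first halves when the start is block
  \<open>d\<close>. Each alignment costs one \<open>LT_word\<close>, whence the factor 2.\<close>

lemma sum_shift_le_LT_word:
  fixes B :: "nat \<Rightarrow> nat list"
  assumes d: "d > 0"
  shows "(\<Sum>i<N-d. LCS (B i) (B (i + d))) \<le> 2 * LT_word (concat (map B [0..<N]))"
proof -
  \<comment> \<open>Padding by empty blocks completes the last superblocks, so that \<open>N\<close>
    superblocks may be used without divisibility conditions.\<close>
  define A where "A i = (if i < N then B i else [])" for i
  define g where "g i = LCS (A i) (A (i + d))" for i
  have split: "(\<Sum>i<2*d*q. g i) = (\<Sum>j<q. \<Sum>i<d. g (2 * d * j + i)) + (\<Sum>j<q. \<Sum>i<d. g (d + 2 * d * j + i))" for q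
  proof (induction q)
    case (Suc q)
    have e: "2 * d * Suc q = 2 * d * q + (d + d)" by simp
    show ?case unfolding e sum_lessThan_add using Suc by (simp add: add_ac)
  qed simp
  have N: "N \<le> 2 * d * N" using d by simp
  have cut: "concat (map A [0..<b]) = concat (map B [0..<N])" if "N \<le> b" for b
  proof -
    have "concat (map A [0..<N]) = concat (map B [0..<N])"
      by (intro arg_cong[where f=concat] map_cong) (auto simp: A_def)
    moreover have "concat (map A [N..<b]) = []" by (auto simp: A_def)
    ultimately show ?thesis using concat_split_block[of 0 N b A] that by simp
  qed
  have "(\<Sum>i<N-d. LCS (B i) (B (i + d))) = (\<Sum>i<N-d. g i)"
    by (intro sum.cong) (auto simp: g_def A_def)
  also have "\<dots> \<le> (\<Sum>i<2*d*N. g i)"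
    using order.trans[OF diff_le_self N] by (intro sum_mono2) (simp_all only: lessThan_subset_iff finite_lessThan le0)
  also have "\<dots> \<le> LT_word (concat (map A [0..<2*d*N])) + LT_word (concat (map A [d..<d+2*d*N]))"
    unfolding split
  proof (rule add_mono)
    show "(\<Sum>j<N. \<Sum>i<d. g (2 * d * j + i)) \<le> LT_word (concat (map A [0..<2*d*N]))"
      using LT_word_superblocks[where B = A and a = 0] by (simp add: g_def)
    show "(\<Sum>j<N. \<Sum>i<d. g (d + 2 * d * j + i)) \<le> LT_word (concat (map A [d..<d+2*d*N]))"
      unfolding g_def by (rule LT_word_superblocks)
  qed
  also have "LT_word (concat (map A [d..<d+2*d*N])) \<le> LT_word (concat (map A [0..<d+2*d*N]))"
    using LT_word_superadditive[of "concat (map A [0..<d])" "concat (map A [d..<d+2*d*N])"]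
    by (subst concat_split_block[of 0 d]) auto
  finally show ?thesis using N by (simp add: cut)
qed

text \<open>The diagonal costs at most \<open>M\<close> per block. Pairs above it are grouped by
  their difference \<open>d\<close>, each group costing at most \<open>2 * LT_word\<close>; symmetry
  doubles this.\<close>

lemma sum_LCS_blocks_le:
  fixes B :: "nat \<Rightarrow> nat list"
  assumes "\<And>i. i < N \<Longrightarrow> length (B i) \<le> M"
  shows "(\<Sum>i<N. \<Sum>j<N. LCS (B i) (B j)) \<le> N * M + 4 * N * LT_word (concat (map B [0..<N]))"
proof -
  let ?f = "\<lambda>(i, j). LCS (B i) (B j)"
  let ?U = "{(i, j). i < j \<and> j < N}" and ?L = "{(i, j). j < i \<and> i < N}" and ?D = "(\<lambda>i. (i, i)) ` {..<N}"
  have finU: "finite ?U" and finL: "finite ?L"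
    by (rule finite_subset[of _ "{..<N} \<times> {..<N}"]; auto)+
  have "?U = (\<lambda>(d, i). (i, i + d)) ` (SIGMA d:{1..<N}. {..<N-d})" (is "_ = _ ` ?S")
  proof (intro equalityI subsetI)
    fix x assume "x \<in> ?U"
    then show "x \<in> (\<lambda>(d, i). (i, i + d)) ` ?S"
      by (intro image_eqI[of _ _ "(snd x - fst x, fst x)"]) auto
  qed auto
  then have "sum ?f ?U = (\<Sum>d\<in>{1..<N}. \<Sum>i<N-d. LCS (B i) (B (i + d)))"
    by (simp add: sum.reindex inj_on_def sum.Sigma case_prod_beta)
  also have "\<dots> \<le> (\<Sum>d\<in>{1..<N}. 2 * LT_word (concat (map B [0..<N])))"
    by (intro sum_mono sum_shift_le_LT_word) auto
  also have "\<dots> \<le> N * (2 * LT_word (concat (map B [0..<N])))"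
    by simp
  finally have U: "sum ?f ?U \<le> N * (2 * LT_word (concat (map B [0..<N])))" .
  have L: "sum ?f ?L = sum ?f ?U"
    by (rule sum.reindex_bij_witness[of _ prod.swap prod.swap]) (auto simp: LCS_commute)
  have D: "sum ?f ?D \<le> N * M"
    using sum_bounded_above[of "{..<N}" "\<lambda>i. LCS (B i) (B i)" M] assms LCS_le_length order.trans
    by (fastforce simp: sum.reindex inj_on_def)
  have "(\<Sum>i<N. \<Sum>j<N. LCS (B i) (B j)) = sum ?f ({..<N} \<times> {..<N})"
    by (simp add: sum.cartesian_product)
  also have "{..<N} \<times> {..<N} = ?U \<union> ?L \<union> ?D" by auto
  also have "sum ?f (?U \<union> ?L \<union> ?D) = sum ?f ?U + sum ?f ?L + sum ?f ?D"
    using finU finL by (subst sum.union_disjoint | auto)+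
  finally show ?thesis using U L D by simp
qed

section \<open>Random permutations made from random blocks\<close>

text \<open>The hypothesis is applied to the law of \<open>\<sigma> x\<close> for uniform
  \<open>x\<close> in \<open>A\<close>; an independent pair of such \<open>x\<close> is uniform on
  \<open>A \<times> A\<close>, which turns the expectation into a double sum.\<close>

lemma sum_LCS_perms_ge:
  assumes H: "\<And>p :: nat list pmf. set_pmf p \<subseteq> perms k \<Longrightarrow>
     measure_pmf.expectation (pair_pmf p p) (\<lambda>(\<pi>1, \<pi>2). real (LCS \<pi>1 \<pi>2)) \<ge> sqrt (real k)"
    and A: "finite A" "A \<noteq> {}" and \<sigma>: "\<And>x. x \<in> A \<Longrightarrow> \<sigma> x \<in> perms k"
  shows "sqrt (real k) * real (card A) ^ 2 \<le> (\<Sum>x\<in>A. \<Sum>y\<in>A. real (LCS (\<sigma> x) (\<sigma> y)))"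
proof -
  define p where "p = map_pmf \<sigma> (pmf_of_set A)"
  have "pair_pmf (pmf_of_set A) (pmf_of_set A) = pmf_of_set (A \<times> A)"
    using A by (intro pmf_eqI, clarify)
      (simp add: pmf_pair indicator_def card_cartesian_product del: ex_in_conv)
  then have pp: "pair_pmf p p = map_pmf (\<lambda>(x, y). (\<sigma> x, \<sigma> y)) (pmf_of_set (A \<times> A))"
    by (simp add: p_def map_pair[symmetric])
  have "set_pmf p \<subseteq> perms k" using A \<sigma> by (auto simp: p_def)
  from H[OF this] have "sqrt (real k) \<le>
    measure_pmf.expectation (pair_pmf p p) (\<lambda>(\<pi>1, \<pi>2). real (LCS \<pi>1 \<pi>2))" .
  also have "pair_pmf p p = map_pmf (\<lambda>(x, y). (\<sigma> x, \<sigma> y)) (pmf_of_set (A \<times> A))"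
    by (rule pp)
  also have "measure_pmf.expectation \<dots> (\<lambda>(\<pi>1, \<pi>2). real (LCS \<pi>1 \<pi>2))
      = (\<Sum>(x, y)\<in>A \<times> A. real (LCS (\<sigma> x) (\<sigma> y))) / real (card (A \<times> A))"
    using A by (simp add: integral_pmf_of_set case_prod_beta)
  also have "\<dots> = (\<Sum>x\<in>A. \<Sum>y\<in>A. real (LCS (\<sigma> x) (\<sigma> y))) / real (card A) ^ 2"
    by (simp add: sum.cartesian_product card_cartesian_product power2_eq_square)
  finally show ?thesis using A by (simp add: le_divide_eq card_gt_0_iff)
qed

text \<open>Each of the \<open>t\<close> entries of a uniform list is uniform on
  \<open>{..<N}\<close>, so the mean of the sum is \<open>t\<close> times the mean of
  \<open>F\<close>. The factor \<open>N\<close> on the left avoids the exponent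
  \<open>t - 1\<close>.\<close>

lemma sum_lists_length:
  fixes F :: "nat \<Rightarrow> real"
  shows "real N * (\<Sum>xs | set xs \<subseteq> {..<N} \<and> length xs = t. \<Sum>i\<leftarrow>xs. F i) = real t * real N ^ t * (\<Sum>i<N. F i)"
proof (induction t)
  case 0
  have "{xs :: nat list. set xs \<subseteq> {..<N} \<and> length xs = 0} = {[]}" by auto
  then show ?case by simp
next
  case (Suc t)
  let ?L = "\<lambda>t. {xs :: nat list. set xs \<subseteq> {..<N} \<and> length xs = t}"
  have "?L (Suc t) = (\<lambda>(i, xs). i # xs) ` ({..<N} \<times> ?L t)"
    by (auto simp: length_Suc_conv image_iff)
  then have "(\<Sum>xs\<in>?L (Suc t). \<Sum>i\<leftarrow>xs. F i) = (\<Sum>(i, xs)\<in>{..<N} \<times> ?L t. F i + (\<Sum>i\<leftarrow>xs. F i))"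
    by (simp add: sum.reindex inj_on_def case_prod_beta)
  also have "\<dots> = (\<Sum>i<N. real N ^ t * F i + (\<Sum>xs\<in>?L t. \<Sum>i\<leftarrow>xs. F i))"
    by (simp add: sum.cartesian_product[symmetric] sum.distrib card_lists_length_eq)
  also have "\<dots> = real N ^ t * (\<Sum>i<N. F i) + real N * (\<Sum>xs\<in>?L t. \<Sum>i\<leftarrow>xs. F i)"
    by (simp add: sum.distrib sum_distrib_left)
  finally show ?case unfolding Suc.IH by (simp add: algebra_simps)
qed

lemma sum_sum_list_swap:
  fixes f :: "'a \<Rightarrow> 'b \<Rightarrow> real"
  shows "(\<Sum>y\<in>A. \<Sum>x\<leftarrow>xs. f x y) = (\<Sum>x\<leftarrow>xs. \<Sum>y\<in>A. f x y)"
  by (induction xs) (simp_all add: sum.distrib)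

lemma sum_sum_lists_length:
  fixes f :: "nat \<Rightarrow> nat \<Rightarrow> real" and N t :: nat
  defines "L \<equiv> {xs. set xs \<subseteq> {..<N} \<and> length xs = t}"
  shows "real N ^ 2 * (\<Sum>xs\<in>L. \<Sum>ys\<in>L. \<Sum>i\<leftarrow>xs. \<Sum>j\<leftarrow>ys. f i j)
    = (real t * real N ^ t) ^ 2 * (\<Sum>i<N. \<Sum>j<N. f i j)"
proof -
  let ?F = "\<lambda>i. \<Sum>ys\<in>L. \<Sum>j\<leftarrow>ys. f i j"
  have "real N ^ 2 * (\<Sum>xs\<in>L. \<Sum>ys\<in>L. \<Sum>i\<leftarrow>xs. \<Sum>j\<leftarrow>ys. f i j) = real N * (real N * (\<Sum>xs\<in>L. \<Sum>i\<leftarrow>xs. ?F i))"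
    by (simp add: sum_sum_list_swap power2_eq_square)
  also have "\<dots> = real t * real N ^ t * (\<Sum>i<N. real N * ?F i)"
    unfolding L_def by (subst sum_lists_length) (simp add: sum_distrib_left[symmetric] mult_ac)
  also have "\<dots> = real t * real N ^ t * (\<Sum>i<N. real t * real N ^ t * (\<Sum>j<N. f i j))"
    unfolding L_def sum_lists_length ..
  finally show ?thesis by (simp add: sum_distrib_left[symmetric] power2_eq_square)
qed

text \<open>A list of \<open>t\<close> random blocks is made into a permutation of \<open>S\<close>:
  restrict to \<open>S\<close>, keep one copy of each letter, append the missing ones. Two such
  permutations have an \<open>LCS\<close> bounded by the sum over the \<open>t ^ 2\<close> pairs of
  blocks plus the two numbers of missing letters. A given letter is missing with probability at most
  \<open>(1 - q) ^ t\<close>, hence at most \<open>exp (- (q * t))\<close>.\<close>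

lemma sqrt_card_le_average_LCS:
  fixes B :: "nat \<Rightarrow> nat list"
  assumes H: "\<And>p :: nat list pmf. set_pmf p \<subseteq> perms (card S) \<Longrightarrow>
     measure_pmf.expectation (pair_pmf p p) (\<lambda>(\<pi>1, \<pi>2). real (LCS \<pi>1 \<pi>2)) \<ge> sqrt (real (card S))"
    and S: "finite S" and N: "N > 0"
    and freq: "\<And>a. a \<in> S \<Longrightarrow> q * real N \<le> real (card {i. i < N \<and> a \<in> set (B i)})"
  shows "sqrt (real (card S)) \<le>
    real t ^ 2 * (\<Sum>i<N. \<Sum>j<N. real (LCS (B i) (B j))) / real N ^ 2 + 2 * real (card S) * exp (- (q * real t))"
proof -
  define L where "L = {xs. set xs \<subseteq> {..<N} \<and> length xs = t}"
  define c where "c x = concat (map (\<lambda>i. filter (\<lambda>a. a \<in> S) (B i)) x)" for x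
  define miss where "miss x = sorted_list_of_set (S - set (c x))" for x
  have finL: "finite L" and cardL: "card L = N ^ t"
    by (simp_all add: L_def finite_lists_length_eq card_lists_length_eq)
  have neL: "L \<noteq> {}" using cardL N by auto
  \<comment> \<open>\<open>perms\<close> consists of permutations of an initial segment, so
    \<open>S\<close> is relabelled.\<close>
  obtain g where g: "bij_betw g S {1..card S}"
    using S by (metis card_atLeastAtMost diff_Suc_1 finite_same_card_bij finite_atLeastAtMost)
  define \<sigma> where "\<sigma> x = map g (remdups (c x) @ miss x)" for x
  have cS: "set (c x) \<subseteq> S" for x by (auto simp: c_def)
  have set_cm: "set (remdups (c x) @ miss x) = S" for x
    using cS S by (auto simp: miss_def)
  have miss_le: "(\<Sum>x\<in>L. real (length (miss x))) \<le> real (card S) * (real (card L) * exp (- (q * real t)))"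
  proof -
    have "(\<Sum>x\<in>L. real (length (miss x))) = (\<Sum>x\<in>L. \<Sum>a\<in>S. if a \<notin> set (c x) then 1 else 0)"
    proof (rule sum.cong[OF refl])
      fix x
      have "S - set (c x) = {a \<in> S. a \<notin> set (c x)}" by auto
      then show "real (length (miss x)) = (\<Sum>a\<in>S. if a \<notin> set (c x) then 1 else 0)"
        using S by (simp add: miss_def flip: sum.inter_filter)
    qed
    also have "\<dots> = (\<Sum>a\<in>S. \<Sum>x\<in>L. if a \<notin> set (c x) then 1 else 0)"
      by (rule sum.swap)
    also have "\<dots> \<le> (\<Sum>a\<in>S. real (card L) * exp (- (q * real t)))"
    proof (rule sum_mono)
      fix a assume a: "a \<in> S"
      let ?G = "{i. i < N \<and> a \<notin> set (B i)}"
      have "(\<Sum>x\<in>L. if a \<notin> set (c x) then 1 else 0) = real (card {x \<in> L. a \<notin> set (c x)})"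
        using finL by (simp flip: sum.inter_filter)
      \<comment> \<open>A letter is missed exactly when all \<open>t\<close> blocks drawn avoid
        it.\<close>
      also have "{x \<in> L. a \<notin> set (c x)} = {x. set x \<subseteq> ?G \<and> length x = t}"
        using a by (auto simp: L_def c_def)
      also have "real (card \<dots>) = real (card ?G) ^ t"
        by (simp add: card_lists_length_eq)
      also have "\<dots> \<le> (real N * exp (- q)) ^ t"
      proof (rule power_mono)
        have "?G = {..<N} - {i. i < N \<and> a \<in> set (B i)}" by auto
        then have "card ?G = N - card {i. i < N \<and> a \<in> set (B i)}"
          by (simp add: card_Diff_subset subset_iff)
        moreover have "card {i. i < N \<and> a \<in> set (B i)} \<le> N"
          using card_mono[of "{..<N}" "{i. i < N \<and> a \<in> set (B i)}"] by auto
        ultimately have "real (card ?G) \<le> real N * (1 - q)"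
          using freq[OF a] by (simp add: algebra_simps)
        also have "\<dots> \<le> real N * exp (- q)"
          using exp_ge_add_one_self[of "- q"] by (intro mult_left_mono) auto
        finally show "real (card ?G) \<le> real N * exp (- q)" .
      qed simp
      also have "\<dots> = real (card L) * exp (- (q * real t))"
        by (simp add: cardL power_mult_distrib exp_of_nat_mult[symmetric] mult.commute)
      finally show "(\<Sum>x\<in>L. if a \<notin> set (c x) then 1 else 0) \<le> real (card L) * exp (- (q * real t))" .
    qed
    finally show ?thesis by simp
  qed
  have "\<sigma> x \<in> perms (card S)" for x
  proof -
    have "distinct (remdups (c x) @ miss x)" using S by (auto simp: miss_def)
    then have "distinct (\<sigma> x)"
      unfolding \<sigma>_def distinct_map set_cm using g by (simp add: bij_betw_def)
    moreover have "set (\<sigma> x) = {1..card S}"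
      unfolding \<sigma>_def set_map set_cm using g by (simp add: bij_betw_def)
    ultimately show ?thesis by (simp add: perms_def)
  qed
  from sum_LCS_perms_ge[OF H finL neL this]
  have "sqrt (real (card S)) * real (card L) ^ 2 \<le> (\<Sum>x\<in>L. \<Sum>y\<in>L. real (LCS (\<sigma> x) (\<sigma> y)))" .
  also have "\<dots> \<le> (\<Sum>x\<in>L. \<Sum>y\<in>L. (\<Sum>i\<leftarrow>x. \<Sum>j\<leftarrow>y. real (LCS (B i) (B j)))
      + real (length (miss x)) + real (length (miss y)))"
  proof (intro sum_mono)
    fix x y
    \<comment> \<open>\<open>LCS_map\<close> bounds the \<open>LCS\<close> before a map by the one
      after it; using the inverse of \<open>g\<close> therefore returns to the original letters in
      the required direction.\<close>
    let ?h = "the_inv_into S g"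
    have h: "map ?h (\<sigma> z) = remdups (c z) @ miss z" for z
    proof -
      have "map ?h (\<sigma> z) = map id (remdups (c z) @ miss z)"
        unfolding \<sigma>_def map_map
        by (rule map_cong[OF refl]) (use g set_cm[of z] in \<open>auto simp: bij_betw_def the_inv_into_f_f\<close>)
      then show ?thesis by simp
    qed
    have "LCS (\<sigma> x) (\<sigma> y) \<le> LCS (remdups (c x) @ miss x) (remdups (c y) @ miss y)"
      using LCS_map[of "\<sigma> x" "\<sigma> y" ?h] by (simp only: h)
    also have "\<dots> \<le> LCS (remdups (c x)) (remdups (c y)) + length (miss x) + length (miss y)"
      using LCS_append_left[of "remdups (c x)" "miss x" "remdups (c y) @ miss y"]
        LCS_append_right[of "remdups (c x)" "remdups (c y)" "miss y"]
        LCS_le_length[of "miss x" "remdups (c y) @ miss y"] LCS_le_length[of "miss y" "remdups (c x)"]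
      by (simp add: LCS_commute[of _ "miss y"])
    also have "LCS (remdups (c x)) (remdups (c y)) \<le> LCS (c x) (c y)"
      by (intro LCS_mono subseq_remdups)
    also have "LCS (c x) (c y) \<le> LCS (concat (map B x)) (concat (map B y))"
    proof -
      have "c z = filter (\<lambda>a. a \<in> S) (concat (map B z))" for z
        by (simp add: c_def filter_concat o_def)
      then show ?thesis by (simp add: LCS_mono)
    qed
    also have "\<dots> \<le> (\<Sum>i\<leftarrow>x. \<Sum>j\<leftarrow>y. LCS (B i) (B j))"
      using LCS_concat[of "map B x" "map B y"] by (simp add: o_def)
    finally have "real (LCS (\<sigma> x) (\<sigma> y)) \<le> real ((\<Sum>i\<leftarrow>x. \<Sum>j\<leftarrow>y. LCS (B i) (B j)) + length (miss x) + length (miss y))"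
      by simp
    also have "real ((\<Sum>i\<leftarrow>x. \<Sum>j\<leftarrow>y. LCS (B i) (B j)) + length (miss x) + length (miss y)) =
        (\<Sum>i\<leftarrow>x. \<Sum>j\<leftarrow>y. real (LCS (B i) (B j))) + real (length (miss x)) + real (length (miss y))"
    proof -
      have "real (\<Sum>i\<leftarrow>xs. f i) = (\<Sum>i\<leftarrow>xs. real (f i))" for xs and f :: "nat \<Rightarrow> nat"
        by (induction xs) auto
      then show ?thesis by simp
    qed
    finally show "real (LCS (\<sigma> x) (\<sigma> y)) \<le> (\<Sum>i\<leftarrow>x. \<Sum>j\<leftarrow>y. real (LCS (B i) (B j))) + real (length (miss x)) + real (length (miss y))" .
  qed
  also have "\<dots> = (\<Sum>x\<in>L. \<Sum>y\<in>L. \<Sum>i\<leftarrow>x. \<Sum>j\<leftarrow>y. real (LCS (B i) (B j)))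
      + 2 * real (card L) * (\<Sum>x\<in>L. real (length (miss x)))"
    by (simp add: sum.distrib sum_distrib_left mult.assoc)
  also have "(\<Sum>x\<in>L. \<Sum>y\<in>L. \<Sum>i\<leftarrow>x. \<Sum>j\<leftarrow>y. real (LCS (B i) (B j)))
     = (real t * real (card L)) ^ 2 * (\<Sum>i<N. \<Sum>j<N. real (LCS (B i) (B j))) / real N ^ 2"
    using sum_sum_lists_length[where N = N and t = t and f = "\<lambda>i j. real (LCS (B i) (B j))"] N
    unfolding L_def[symmetric] cardL by (simp add: field_simps)
  also have "(real t * real (card L)) ^ 2 * (\<Sum>i<N. \<Sum>j<N. real (LCS (B i) (B j))) / real N ^ 2
      + 2 * real (card L) * (\<Sum>x\<in>L. real (length (miss x)))
    \<le> (real t * real (card L)) ^ 2 * (\<Sum>i<N. \<Sum>j<N. real (LCS (B i) (B j))) / real N ^ 2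
      + 2 * real (card L) * (real (card S) * (real (card L) * exp (- (q * real t))))"
    by (intro add_left_mono mult_left_mono miss_le) auto
  finally have "sqrt (real (card S)) * real (card L) ^ 2 \<le>
      (real t ^ 2 * (\<Sum>i<N. \<Sum>j<N. real (LCS (B i) (B j))) / real N ^ 2 + 2 * real (card S) * exp (- (q * real t)))
      * real (card L) ^ 2"
    by (simp add: algebra_simps power2_eq_square)
  moreover have "real (card L) ^ 2 > 0" using N by (simp add: cardL)
  ultimately show ?thesis by (rule mult_right_le_imp_le)
qed

section \<open>Few or many distinct letters per block\<close>

lemma cube_powr_third: "x \<ge> 0 \<Longrightarrow> (x ^ 3) powr (1/3) = (x::real)"
  by (cases "x = 0") (auto simp: powr_def ln_realpow)

text \<open>The first alternative holds if at least half of the blocks have at most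
  \<open>M / 4\<close> distinct letters. Otherwise the random-block argument is run on the frequent
  letters; the loss \<open>M / 4\<close> comes from the diagonal in
  \<open>sum_LCS_blocks_le\<close>.\<close>

lemma LT_word_ge_blocks:
  fixes w :: "nat list" and k N M :: nat
  assumes H: "\<And>(k::nat) (p :: nat list pmf). k > 0 \<Longrightarrow> set_pmf p \<subseteq> perms k \<Longrightarrow>
     measure_pmf.expectation (pair_pmf p p) (\<lambda>(\<pi>1, \<pi>2). real (LCS \<pi>1 \<pi>2)) \<ge> sqrt (real k)"
    and k: "k > 0" and N: "N > 0" and M: "M > 0"
    and w: "length w = N * M" "set w \<subseteq> {1..k}"
  shows "real N * ((real M / 6) powr (1/3) / 2) \<le> real (LT_word w) \<or>
    real N * (real M ^ 2 * sqrt (real M) / (8192 * real k ^ 2 * (ln (real k) / 2 + 12/5) ^ 2)) - real M / 4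
      \<le> real (LT_word w)"
proof -
  define B where "B i = take M (drop (i * M) w)" for i
  have "concat (map B [0..<n]) = take (n * M) w" for n
    by (induction n) (simp_all add: B_def take_add[symmetric] add.commute)
  with w(1) have conc: "concat (map B [0..<N]) = w" by simp
  have lenB: "length (B i) = M" if "i < N" for i
  proof -
    have "(i + 1) * M \<le> N * M" using that by (intro mult_right_mono) auto
    then show ?thesis by (simp add: B_def w(1))
  qed
  have setB: "set (B i) \<subseteq> {1..k}" for i
    using w(2) set_take_subset[of M "drop (i * M) w"] set_drop_subset[of "i * M" w] unfolding B_def by blast
  define G where "G = {i. i < N \<and> M < 4 * card (set (B i))}"
  have G: "G \<subseteq> {..<N}" and finG: "finite G" by (auto simp: G_def)
  show ?thesis
  proof (cases "N \<le> 2 * card ({..<N} - G)")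
    case True
    have "(real M / 6) powr (1/3) \<le> real (LT_word (B i))" if "i \<in> {..<N} - G" for i
    proof -
      have "M \<le> 3 * LT_word (B i) ^ 3 + 2 * card (set (B i))"
        using length_le_LT_word_cube[of "B i"] lenB[of i] that by simp
      moreover have "4 * card (set (B i)) \<le> M" using that by (auto simp: G_def)
      ultimately have "M \<le> 6 * LT_word (B i) ^ 3" by linarith
      then have "real M \<le> 6 * real (LT_word (B i)) ^ 3"
        by (metis of_nat_le_iff of_nat_mult of_nat_numeral of_nat_power)
      then have "(real M / 6) powr (1/3) \<le> (real (LT_word (B i)) ^ 3) powr (1/3)"
        by (intro powr_mono2) auto
      then show ?thesis by (simp add: cube_powr_third)
    qed
    then have "real (card ({..<N} - G)) * (real M / 6) powr (1/3) \<le> (\<Sum>i\<in>{..<N} - G. real (LT_word (B i)))"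
      using sum_bounded_below[of "{..<N} - G" "(real M / 6) powr (1/3)"] by simp
    also have "\<dots> \<le> (\<Sum>i<N. real (LT_word (B i)))"
      by (intro sum_mono2) auto
    also have "\<dots> = real (\<Sum>u\<leftarrow>map B [0..<N]. LT_word u)"
      by (simp add: interv_sum_list_conv_sum_set_nat o_def atLeast0LessThan)
    also have "\<dots> \<le> real (LT_word w)"
      using LT_word_concat[of "map B [0..<N]"] conc by simp
    finally have 1: "real (card ({..<N} - G)) * (real M / 6) powr (1/3) \<le> real (LT_word w)" .
    have "real N / 2 * (real M / 6) powr (1/3) \<le> real (card ({..<N} - G)) * (real M / 6) powr (1/3)"
      using True by (intro mult_right_mono) auto
    with 1 show ?thesis by simp
  next
    case False
    then have cG: "N \<le> 2 * card G"
      using G finG by (simp add: card_Diff_subset)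
    define c where "c a = card {i. i < N \<and> a \<in> set (B i)}" for a
    have cN: "c a \<le> N" for a
      using card_mono[of "{..<N}" "{i. i < N \<and> a \<in> set (B i)}"] by (auto simp: c_def)
    \<comment> \<open>Incidences between blocks and letters are counted by block, then by
      letter.\<close>
    have "real N * real M / 8 \<le> real (card G) * (real M / 4)"
      using mult_right_mono[of "real N" "2 * real (card G)" "real M / 8"] cG by (simp add: mult_ac)
    also have "\<dots> \<le> (\<Sum>i\<in>G. real (card (set (B i))))"
    proof (rule sum_bounded_below)
      fix i assume "i \<in> G"
      then have "real M \<le> real (4 * card (set (B i)))" unfolding G_def by (simp del: of_nat_mult)
      then show "real M / 4 \<le> real (card (set (B i)))" by simp
    qed
    also have "\<dots> \<le> (\<Sum>i<N. real (card (set (B i))))"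
      using G by (intro sum_mono2) auto
    also have "\<dots> = (\<Sum>i<N. \<Sum>a\<in>{1..k}. if a \<in> set (B i) then 1 else 0)"
    proof (rule sum.cong[OF refl])
      fix i
      have "set (B i) = {a \<in> {1..k}. a \<in> set (B i)}" using setB[of i] by auto
      then have "real (card (set (B i))) = (\<Sum>a | a \<in> {1..k} \<and> a \<in> set (B i). 1)" by simp
      then show "real (card (set (B i))) = (\<Sum>a\<in>{1..k}. if a \<in> set (B i) then 1 else 0)"
        by (simp only: sum.inter_filter[OF finite_atLeastAtMost])
    qed
    also have "\<dots> = (\<Sum>a\<in>{1..k}. \<Sum>i<N. if a \<in> set (B i) then 1 else 0)"
      by (rule sum.swap)
    also have "\<dots> = (\<Sum>a\<in>{1..k}. real (c a))"
      by (intro sum.cong refl) (simp add: c_def flip: sum.inter_filter)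
    finally have sum_c: "real N * real M / 8 \<le> (\<Sum>a\<in>{1..k}. real (c a))" .
    \<comment> \<open>Letters below the threshold \<open>q * N\<close> contribute at most
      \<open>k * q * N = N * M / 16\<close>, half of the bound in \<open>sum_c\<close>. Every other
      letter contributes at most \<open>N\<close>, so at least \<open>M / 16\<close> letters are
      frequent.\<close>
    define q where "q = real M / (16 * real k)"
    have q: "q > 0" using k M by (simp add: q_def)
    define S where "S = {a \<in> {1..k}. q * real N \<le> real (c a)}"
    have finS: "finite S" and Sk: "card S \<le> k"
    proof -
      have "S \<subseteq> {1..k}" by (auto simp: S_def)
      then show "finite S" "card S \<le> k"
        using card_mono[of "{1..k}" S] by (auto intro: finite_subset)
    qed
    have "(\<Sum>a\<in>{1..k}. real (c a)) = (\<Sum>a\<in>S. real (c a)) + (\<Sum>a\<in>{1..k} - S. real (c a))"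
      by (subst sum.subset_diff[of S]) (auto simp: S_def)
    also have "\<dots> \<le> real (card S) * real N + real (card ({1..k} - S)) * (q * real N)"
      using cN by (intro add_mono sum_bounded_above) (auto simp: S_def)
    also have "\<dots> \<le> real (card S) * real N + real k * (q * real N)"
      using q card_mono[of "{1..k}" "{1..k} - S", OF _ Diff_subset] by (intro add_left_mono mult_right_mono) auto
    also have "real k * (q * real N) = real N * real M / 16"
      using k by (simp add: q_def)
    finally have "real N * (real M / 16) \<le> real N * real (card S)"
      using sum_c by (simp add: mult.commute)
    then have KM: "real M / 16 \<le> real (card S)" using N by simp
    then have K: "card S > 0" using M by (cases "card S") auto
    \<comment> \<open>This controls the rounding of \<open>b / q\<close> up to \<open>t\<close>:
      \<open>q * t\<close> is at most \<open>b + q\<close>, hence at most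
      \<open>b + 1\<close>.\<close>
    have q1: "q \<le> 1"
    proof -
      obtain a where "a \<in> S" using K by (metis card.empty ex_in_conv less_irrefl)
      then have "q * real N \<le> 1 * real N" using cN[of a] by (simp add: S_def)
      then show ?thesis using N by simp
    qed
    \<comment> \<open>Since \<open>exp (- b) = 1 / (4 * sqrt (card S))\<close>, any \<open>t\<close>
      with \<open>q * t\<close> at least \<open>b\<close> makes the missing letters cost at most
      half of \<open>sqrt (card S)\<close>. In \<open>y\<close>, the constant 12/5 is 1 plus the
      bound 7/5 on \<open>ln 4\<close>.\<close>
    define b where "b = ln (real (card S)) / 2 + ln 4"
    define y where "y = ln (real k) / 2 + 12/5"
    have b0: "b > 0" using K by (simp add: b_def add_nonneg_pos)
    have "ln (4::real) = 2 * ln 2" using ln_realpow[of "2::real" 2] by simp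
    then have "ln (4::real) \<le> 7/5" using ln2_le_25_over_36 by simp
    moreover have "ln (real (card S)) \<le> ln (real k)" using K Sk by simp
    ultimately have by1: "b + 1 \<le> y" by (simp add: b_def y_def)
    then have y0: "y > 0" using b0 by simp
    define t where "t = nat \<lceil>b / q\<rceil>"
    have "b / q \<le> real t" unfolding t_def by linarith
    then have tb: "b \<le> q * real t" using q by (simp add: field_simps)
    have "real t \<le> b / q + 1" using b0 q unfolding t_def by (simp add: ceiling_correct le_of_int_ceiling)
    then have "q * real t \<le> b + q" using q by (simp add: field_simps)
    then have ty: "q * real t \<le> y" using by1 q1 by simp
    define T where "T = (\<Sum>i<N. \<Sum>j<N. real (LCS (B i) (B j)))"
    have "exp (- (q * real t)) \<le> exp (- b)" using tb by simp
    also have "\<dots> = 1 / (4 * sqrt (real (card S)))"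
    proof -
      have "exp (ln (real (card S)) / 2) = sqrt (real (card S))"
        using K by (simp add: powr_half_sqrt[symmetric] powr_def)
      then have "exp b = sqrt (real (card S)) * 4" unfolding b_def exp_add by simp
      then show ?thesis by (simp add: exp_minus inverse_eq_divide mult.commute)
    qed
    finally have "2 * real (card S) * exp (- (q * real t)) \<le> 2 * real (card S) * (1 / (4 * sqrt (real (card S))))"
      by (intro mult_left_mono) auto
    also have "\<dots> = sqrt (real (card S)) / 2"
      using K real_sqrt_mult_self[of "real (card S)"] by (simp add: field_simps)
    finally have small: "2 * real (card S) * exp (- (q * real t)) \<le> sqrt (real (card S)) / 2" .
    have "sqrt (real (card S)) \<le>
        real t ^ 2 * T / real N ^ 2 + 2 * real (card S) * exp (- (q * real t))"
      unfolding T_def by (rule sqrt_card_le_average_LCS[OF H[OF K] finS N]) (simp_all add: S_def c_def)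
    with small have "sqrt (real (card S)) / 2 \<le> real t ^ 2 * T / real N ^ 2" by linarith
    then have "q ^ 2 * (sqrt (real (card S)) / 2) \<le> q ^ 2 * (real t ^ 2 * T / real N ^ 2)"
      by (intro mult_left_mono) auto
    also have "\<dots> = (q * real t) ^ 2 * (T / real N ^ 2)" by (simp add: power_mult_distrib)
    also have "\<dots> \<le> y ^ 2 * (T / real N ^ 2)"
      using ty q by (intro mult_right_mono power_mono divide_nonneg_nonneg) (auto simp: T_def sum_nonneg)
    finally have 2: "q ^ 2 * (sqrt (real (card S)) / 2) \<le> y ^ 2 * (T / real N ^ 2)" .
    have "sqrt (real M) / 4 = sqrt (real M / 16)" by (simp add: real_sqrt_divide)
    also have "\<dots> \<le> sqrt (real (card S))" using KM by simp
    finally have "q ^ 2 * (sqrt (real M) / 8) \<le> q ^ 2 * (sqrt (real (card S)) / 2)"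
      by (intro mult_left_mono) auto
    with 2 have "q ^ 2 * (sqrt (real M) / 8) \<le> y ^ 2 * (T / real N ^ 2)" by linarith
    \<comment> \<open>Here 2048 is \<open>16 ^ 2 * 8\<close>, with \<open>16 ^ 2\<close> from
      \<open>q ^ 2\<close>; the factor 4 before \<open>LT_word\<close> below raises it to
      8192.\<close>
    then have "real N ^ 2 * (real M ^ 2 * sqrt (real M) / (2048 * real k ^ 2 * y ^ 2)) \<le> T"
      using y0 N k by (simp add: q_def field_simps)
    also have "T \<le> real (N * M + 4 * N * LT_word w)"
    proof -
      have "T = real (\<Sum>i<N. \<Sum>j<N. LCS (B i) (B j))" by (simp add: T_def)
      with sum_LCS_blocks_le[of N B M] lenB conc show ?thesis by (simp only: of_nat_le_iff order.refl)
    qed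
    finally have "real N * (real N * (real M ^ 2 * sqrt (real M) / (2048 * real k ^ 2 * y ^ 2)))
        \<le> real N * (real M + 4 * real (LT_word w))"
      by (simp add: power2_eq_square algebra_simps)
    then have "real N * (real M ^ 2 * sqrt (real M) / (2048 * real k ^ 2 * y ^ 2)) \<le> real M + 4 * real (LT_word w)"
      by (rule mult_left_le_imp_le) (use N in simp)
    moreover have "real N * (real M ^ 2 * sqrt (real M) / (8192 * real k ^ 2 * y ^ 2))
        = real N * (real M ^ 2 * sqrt (real M) / (2048 * real k ^ 2 * y ^ 2)) / 4"
      by simp
    ultimately show ?thesis unfolding y_def by linarith
  qed
qed

section \<open>Choice of the block length\<close>

text \<open>With \<open>A\<close> and \<open>Z\<close> the 19th roots of \<open>k\<close> and
  \<open>ln k\<close>, all exponents become integers. Up to constants the first inequality says that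
  \<open>c ^ 3 * M ^ 2\<close> is bounded, which dictates the size of \<open>M\<close>; the second
  then holds with a spare factor \<open>A\<close> that absorbs the excess power of
  \<open>ln k\<close>.\<close>

lemma block_length_exists:
  fixes k :: nat
  assumes k: "k \<ge> 2"
  defines "c \<equiv> (1/100) * real k powr (-12/19) * ln (real k) powr (-8/19)"
  obtains M :: nat where "M > 0" "c * real M \<le> (real M / 6) powr (1/3) / 2"
    "c * real M \<le> real M ^ 2 * sqrt (real M) / (8192 * real k ^ 2 * (ln (real k) / 2 + 12/5) ^ 2)"
proof -
  define x where "x = ln (real k)"
  define A where "A = real k powr (1/19)"
  define Z where "Z = x powr (1/19)"
  have x: "x \<ge> 2/3"
  proof -
    have "ln 2 \<le> x" using k by (simp add: x_def)
    with ln2_ge_two_thirds show ?thesis by simp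
  qed
  have A_exp: "A ^ n = exp (real n * x / 19)" for n
    using k by (simp add: A_def x_def powr_def exp_of_nat_mult[symmetric])
  have A0: "A > 0" and Z0: "Z > 0" using k x by (auto simp: A_def Z_def)
  have kA: "real k = A ^ 19" using k by (simp add: A_exp x_def)
  have xZ: "x = Z ^ 19" using x by (simp add: Z_def powr_power)
  have c: "c = 1 / (100 * A ^ 12 * Z ^ 8)"
  proof -
    have "real k powr (-12/19) = 1 / A ^ 12" "x powr (-8/19) = 1 / Z ^ 8"
      using k x by (simp_all add: A_def Z_def powr_power powr_minus_divide)
    then show ?thesis by (simp add: c_def x_def)
  qed
  \<comment> \<open>the solution of \<open>(4 * c) ^ 3 * Y ^ 2 = 1\<close>\<close>
  define Y where "Y = 125 * A ^ 18 * Z ^ 12"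
  \<comment> \<open>For \<open>k = 2\<close> the logarithm is below 1, so \<open>Z\<close> may be
    too; both ranges need a lower bound.\<close>
  have "Z ^ 12 \<ge> 2/3"
  proof (cases "Z \<le> 1")
    case True
    then have "Z ^ 19 \<le> Z ^ 12" using Z0 by (intro power_decreasing) auto
    with xZ x show ?thesis by simp
  next
    case False
    then have "1 \<le> Z ^ 12" by (intro one_le_power) auto
    then show ?thesis by simp
  qed
  moreover have "A ^ 18 \<ge> 8/5"
  proof -
    have "8/5 \<le> 1 + 18 * x / 19" using x by simp
    also have "\<dots> \<le> A ^ 18" unfolding A_exp of_nat_numeral by (rule exp_ge_add_one_self)
    finally show ?thesis .
  qed
  ultimately have "(8/5) * (2/3) \<le> A ^ 18 * Z ^ 12" using A0 by (intro mult_mono) auto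
  \<comment> \<open>Beyond 100, rounding down loses at most one percent.\<close>
  then have Y: "Y \<ge> 100" unfolding Y_def mult.assoc by linarith
  define M where "M = nat \<lfloor>Y\<rfloor>"
  have MY: "real M \<le> Y" "99/100 * Y \<le> real M" using Y unfolding M_def by linarith+
  have M0: "M > 0" using MY Y by (cases M) auto
  have c0: "c > 0" using A0 Z0 by (simp add: c)
  have "c * real M \<le> (real M / 6) powr (1/3) / 2"
  proof -
    have "real M ^ 2 \<le> Y ^ 2" using MY by (intro power_mono) auto
    \<comment> \<open>By the choice of \<open>Y\<close> the right side is \<open>1/8\<close>, which
      leaves room below the required \<open>1/6\<close>.\<close>
    then have "(2 * c) ^ 3 * real M ^ 2 \<le> (2 * c) ^ 3 * Y ^ 2"
      using c0 by (intro mult_left_mono) auto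
    also have "\<dots> = 1 / 8"
      using A0 Z0 by (simp add: c Y_def power_mult_distrib power_divide flip: power_mult)
    finally have "(2 * c) ^ 3 * real M ^ 2 * real M \<le> 1/8 * real M"
      by (intro mult_right_mono) auto
    then have "(2 * c * real M) ^ 3 \<le> real M / 6"
      by (simp add: power_mult_distrib power3_eq_cube power2_eq_square mult_ac)
    then have "((2 * c * real M) ^ 3) powr (1/3) \<le> (real M / 6) powr (1/3)"
      using c0 by (intro powr_mono2) auto
    moreover have "((2 * c * real M) ^ 3) powr (1/3) = 2 * c * real M"
      using c0 by (intro cube_powr_third) auto
    ultimately show ?thesis by simp
  qed
  moreover have "c * real M \<le> real M ^ 2 * sqrt (real M) / (8192 * real k ^ 2 * (ln (real k) / 2 + 12/5) ^ 2)"
  proof -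
    define y where "y = x / 2 + 12/5"
    have y0: "y > 0" using x by (simp add: y_def)
    have A1: "A \<ge> 1 + x / 19" using exp_ge_add_one_self[of "x / 19"] A_exp[of 1] by simp
    \<comment> \<open>This is what the second inequality needs once powers of \<open>A\<close> and
      \<open>Z\<close> cancel; 167/10 keeps \<open>8192 * 167/10\<close> below
      \<open>100 * 1369\<close>. For \<open>x \<le> 1\<close> one has
      \<open>Z ^ 26 \<ge> Z ^ 38 = x ^ 2\<close>. For larger \<open>x\<close>,
      \<open>Z ^ 26 \<ge> Z ^ 19 = x\<close>, and \<open>A \<ge> 1 + x / 19\<close> supplies the
      quadratic term.\<close>
    have key: "y ^ 2 \<le> 167/10 * (A * Z ^ 26)"
    proof (cases "x \<le> 1")
      case True
      have "Z \<le> 1"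
        using True x powr_mono2[of "1/19" x 1] by (simp add: Z_def)
      then have "x ^ 2 \<le> Z ^ 26"
        unfolding xZ power_mult[symmetric] using Z0 by (intro power_decreasing) auto
      moreover have "A \<ge> 103/100" using A1 x by simp
      ultimately have "103/100 * x ^ 2 \<le> A * Z ^ 26" by (intro mult_mono) auto
      moreover have "0 \<le> A * Z ^ 26" using A0 Z0 by simp
      moreover have "y ^ 2 \<le> (414/100 * x) ^ 2"
        using x by (intro power_mono) (auto simp: y_def)
      ultimately show ?thesis by (simp add: power_mult_distrib power_divide)
    next
      case False
      then have "Z \<ge> 1" using ge_one_powr_ge_zero[of x "1/19"] by (simp add: Z_def)
      then have "x \<le> Z ^ 26" unfolding xZ by (intro power_increasing) auto
      then have "(1 + x / 19) * x \<le> A * Z ^ 26"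
        using A1 x A0 by (intro mult_mono) auto
      moreover have "y ^ 2 \<le> 167/10 * ((1 + x / 19) * x)"
      proof -
        have "y ^ 2 = x ^ 2 / 4 + 12/5 * x + 144/25"
          by (simp add: y_def power2_eq_square field_simps)
        moreover have "167/10 * ((1 + x / 19) * x) = 167/10 * x + 167/190 * x ^ 2"
          by (simp add: power2_eq_square field_simps)
        ultimately show ?thesis using False zero_le_power2[of x] by linarith
      qed
      ultimately show ?thesis by linarith
    qed
    have sY: "sqrt Y = sqrt 125 * (A ^ 9 * Z ^ 6)"
    proof -
      have "Y = 125 * (A ^ 9 * Z ^ 6) ^ 2" by (simp add: Y_def power_mult_distrib flip: power_mult)
      then show ?thesis using A0 Z0 by (simp add: real_sqrt_mult)
    qed
    have "1118/100 \<le> sqrt 125" by (rule real_le_rsqrt) (simp add: power2_eq_square)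
    then have "1118/100 * (A ^ 9 * Z ^ 6) \<le> sqrt Y"
      unfolding sY using A0 Z0 by (intro mult_right_mono) auto
    moreover have "99/100 * sqrt Y \<le> sqrt (real M)"
    proof (rule real_le_rsqrt)
      show "(99/100 * sqrt Y) ^ 2 \<le> real M" using MY Y by (simp add: power_mult_distrib power_divide)
    qed
    ultimately have "99/100 * (1118/100 * (A ^ 9 * Z ^ 6)) \<le> sqrt (real M)" by simp
    \<comment> \<open>One factor 99/100 pays for rounding in \<open>M\<close>, the other for
      rounding in its square root; 1118/100 stands for \<open>sqrt 125\<close>.\<close>
    then have "99/100 * Y * (99/100 * (1118/100 * (A ^ 9 * Z ^ 6))) \<le> real M * sqrt (real M)"
      using MY Y A0 Z0 by (intro mult_mono) auto
    then have MM: "1369 * (A ^ 27 * Z ^ 18) \<le> real M * sqrt (real M)"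
    proof -
      have e: "A ^ 18 * A ^ 9 = A ^ 27" "Z ^ 12 * Z ^ 6 = Z ^ 18" by (simp_all flip: power_add)
      have "99/100 * Y * (99/100 * (1118/100 * (A ^ 9 * Z ^ 6))) = 1369.68975 * ((A ^ 18 * A ^ 9) * (Z ^ 12 * Z ^ 6))" (is "?l = _ * ?r")
        by (simp add: Y_def)
      moreover have "1369 * ?r \<le> 1369.68975 * ?r" using A0 Z0 by (intro mult_right_mono) auto
      ultimately show ?thesis
        using \<open>?l \<le> _\<close> unfolding e by linarith
    qed
    have "8192 * A ^ 26 * y ^ 2 \<le> 8192 * A ^ 26 * (167/10 * (A * Z ^ 26))"
      using key A0 by (intro mult_left_mono) auto
    also have "\<dots> \<le> 136900 * (A ^ 27 * Z ^ 26)"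
    proof -
      have "A ^ 26 * A = A ^ 27" by (simp flip: power_Suc2)
      then have "8192 * A ^ 26 * (167/10 * (A * Z ^ 26)) = 8192 * (167/10) * (A ^ 27 * Z ^ 26)"
        by (simp add: mult_ac)
      also have "\<dots> \<le> 136900 * (A ^ 27 * Z ^ 26)"
        using A0 Z0 by (intro mult_right_mono) auto
      finally show ?thesis .
    qed
    also have "\<dots> = 100 * Z ^ 8 * (1369 * (A ^ 27 * Z ^ 18))"
      by (simp flip: power_add)
    also have "\<dots> \<le> 100 * Z ^ 8 * (real M * sqrt (real M))"
      using MM Z0 by (intro mult_left_mono) auto
    finally have "A ^ 12 * (8192 * A ^ 26 * y ^ 2) \<le> A ^ 12 * (100 * Z ^ 8 * (real M * sqrt (real M)))"
      using A0 by (intro mult_left_mono) auto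
    then have "8192 * real k ^ 2 * y ^ 2 \<le> 100 * A ^ 12 * Z ^ 8 * (real M * sqrt (real M))"
      unfolding kA by (simp add: mult_ac flip: power_mult power_add)
    then have "c * (8192 * real k ^ 2 * y ^ 2) \<le> real M * sqrt (real M)"
      using A0 Z0 by (simp add: c field_simps)
    then have "c \<le> real M * sqrt (real M) / (8192 * real k ^ 2 * y ^ 2)"
      using k y0 by (simp add: le_divide_eq)
    then have "c * real M \<le> real M * sqrt (real M) / (8192 * real k ^ 2 * y ^ 2) * real M"
      by (intro mult_right_mono) auto
    then show ?thesis by (simp add: y_def x_def power2_eq_square mult_ac)
  qed
  ultimately show ?thesis using that M0 by blast
qed

section \<open>Arbitrary lengths and the limit\<close>

theorem theorem10:
  assumes H: "\<And>(k::nat) (p :: nat list pmf). k > 0 \<Longrightarrow> set_pmf p \<subseteq> perms k \<Longrightarrow>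
     measure_pmf.expectation (pair_pmf p p) (\<lambda>(\<pi>1, \<pi>2). real (LCS \<pi>1 \<pi>2)) \<ge> sqrt (real k)"
    and k: "(k::nat) \<ge> 2"
  shows "\<forall>\<epsilon>>0. eventually (\<lambda>n. real (LT k n) / real n \<ge>
           (1/100) * real k powr (-12/19) * ln (real k) powr (-8/19) - \<epsilon>) sequentially"
proof (intro allI impI)
  fix \<epsilon> :: real assume \<epsilon>: "\<epsilon> > 0"
  define c where "c = (1/100) * real k powr (-12/19) * ln (real k) powr (-8/19)"
  have c0: "c \<ge> 0" by (simp add: c_def)
  obtain M :: nat where M: "M > 0" "c * real M \<le> (real M / 6) powr (1/3) / 2"
    "c * real M \<le> real M ^ 2 * sqrt (real M) / (8192 * real k ^ 2 * (ln (real k) / 2 + 12/5) ^ 2)"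
    using block_length_exists[OF k] unfolding c_def by blast
  \<comment> \<open>\<open>D\<close> is independent of the length: it covers the incomplete last
    block, whose removal cannot increase \<open>LT_word\<close>, and the loss \<open>M / 4\<close>
    from \<open>LT_word_ge_blocks\<close>.\<close>
  define D where "D = c * real M + real M / 4"
  have word: "c * real (length w) - D \<le> real (LT_word w)" if w: "set w \<subseteq> {1..k}" for w
  proof (cases "length w div M = 0")
    case True
    then have "length w < M" using M(1) by (simp add: div_eq_0_iff)
    then have "c * real (length w) \<le> c * real M" using c0 by (intro mult_left_mono) auto
    then show ?thesis by (simp add: D_def)
  next
    case False
    define N where "N = length w div M"
    have N: "N > 0" using False by (simp add: N_def)
    define u where "u = take (N * M) w"
    have "N * M \<le> length w" by (simp add: N_def)
    then have u: "length u = N * M" "set u \<subseteq> {1..k}"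
      using w set_take_subset[of "N * M" w] by (auto simp: u_def)
    from M(2) have 1: "real N * (c * real M) \<le> real N * ((real M / 6) powr (1/3) / 2)"
      by (rule mult_left_mono) simp
    from M(3) have 2: "real N * (c * real M) \<le>
        real N * (real M ^ 2 * sqrt (real M) / (8192 * real k ^ 2 * (ln (real k) / 2 + 12/5) ^ 2))"
      by (rule mult_left_mono) simp
    have "real N * (c * real M) - real M / 4 \<le> real (LT_word u)"
    proof -
      have "k > 0" using k by simp
      from LT_word_ge_blocks[OF H this N M(1) u] show ?thesis
      proof
        assume "real N * ((real M / 6) powr (1/3) / 2) \<le> real (LT_word u)"
        with 1 show ?thesis by linarith
      next
        assume "real N * (real M ^ 2 * sqrt (real M) / (8192 * real k ^ 2 * (ln (real k) / 2 + 12/5) ^ 2))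
          - real M / 4 \<le> real (LT_word u)"
        with 2 show ?thesis by linarith
      qed
    qed
    moreover have "LT_word u \<le> LT_word w"
      using LT_word_superadditive[of u "drop (N * M) w"] by (simp add: u_def)
    moreover have "c * real (length w) \<le> c * (real N * real M + real M)"
    proof (intro mult_left_mono c0)
      have "length w \<le> N * M + M"
        using M(1) div_mult_mod_eq[of "length w" M] mod_less_divisor[of M "length w"] unfolding N_def by linarith
      then show "real (length w) \<le> real N * real M + real M"
        by (metis of_nat_add of_nat_le_iff of_nat_mult)
    qed
    ultimately show ?thesis by (simp add: D_def algebra_simps)
  qed
  have LT: "c * real n - D \<le> real (LT k n)" for n
  proof -
    let ?W = "{LT_word w | w. length w = n \<and> set w \<subseteq> {1..k}}"
    have "?W = LT_word ` {w. set w \<subseteq> {1..k} \<and> length w = n}" by auto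
    then have "finite ?W" by (simp add: finite_lists_length_eq)
    \<comment> \<open>A constant word shows that \<open>Min\<close> is taken over a nonempty
      set.\<close>
    moreover have "LT_word (replicate n 1) \<in> ?W"
      using k by (intro CollectI exI[of _ "replicate n 1"]) auto
    ultimately have "LT k n \<in> ?W" unfolding LT_def by (intro Min_in) auto
    then show ?thesis using word by auto
  qed
  have "(\<lambda>n. D / real n) \<longlonglongrightarrow> 0" by (rule lim_const_over_n)
  then have "\<forall>\<^sub>F n in sequentially. D / real n < \<epsilon>"
    using \<epsilon> by (rule order_tendstoD)
  then show "\<forall>\<^sub>F n in sequentially. real (LT k n) / real n \<ge>
      (1/100) * real k powr (-12/19) * ln (real k) powr (-8/19) - \<epsilon>"
    using eventually_gt_at_top[of 0]
  proof eventually_elim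
    case (elim n)
    have "c - D / real n = (c * real n - D) / real n" using elim by (simp add: field_simps)
    also have "\<dots> \<le> real (LT k n) / real n" using LT[of n] by (intro divide_right_mono) auto
    finally show ?case using elim unfolding c_def by linarith
  qed
qed

end
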